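(* For an integer $n\ge 1$ let $A_n=\mathrm{Av}_n(123,132,321)$ be the set of permutations of $\{1,\dots,n\}$ avoiding each of the consecutive patterns $123$, $132$ and $321$; its cardinality is $|A_n|=(n-1)!!+(n-2)!!$. For $p\in\{213,231,312\}$ let $\mathbf{p}_n$ denote the total number of consecutive occurrences of $p$, summed over all permutations in $A_n$. Then for every integer $n\ge 3$, $$\mathbf{231}_n=(n-1)!!\left\lceil\frac{n-3}{2}\right\rceil + (n-2)!!\left\lceil\frac{n-2}{2}\right\rceil,$$ $$\mathbf{312}_n=(n-1)!!\left(\frac{(-1)^{n-1}+n-3}{4} + \frac{1}{2}\sum_{\substack{1\le k\le n-1\\k\not\equiv n \pmod 2}} \frac{1}{k} \right)+(n-2)!!\left(\frac{(-1)^n+n-4}{4} + \frac{1}{2}\sum_{\substack{1\le k\le n-2\\k\equiv n\pmod 2}} \frac{1}{k} \right),$$ $$\mathbf{213}_n=(n-2)\big((n-1)!!+(n-2)!!\big)-\mathbf{231}_n-\mathbf{312}_n.$$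
   Context: A permutation $\pi=a_1\dots a_n$ contains a consecutive occurrence of a pattern $p\in\mathcal S_r$ if there is $i$ such that $a_ia_{i+1}\dots a_{i+r-1}$ is order-isomorphic to $p$; $\pi$ avoids $p$ if it contains no such occurrence. The double factorial is defined by $0!!=1$ and, for $m\ge1$, $m!!=m(m-2)(m-4)\cdots$ down to $1$ (if $m$ odd) or $2$ (if $m$ even).
   Formalization: The cardinality formula |A_n| = (n-1)!!+(n-2)!! is stated for n ≥ 2 only: at n = 1 it would involve (-1)!!, which is not defined here (and the usual value 1 would give 2, while |A_1| = 1). *)

theory Defs
  imports Complex_Main "HOL-Combinatorics.Multiset_Permutations"
begin

fun double_fact :: "nat \<Rightarrow> nat" where
  "double_fact 0 = 1"
| "double_fact (Suc 0) = 1"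
| "double_fact (Suc (Suc m)) = Suc (Suc m) * double_fact m"

text \<open>Permutations and patterns are words in one-line notation, with 0-based list positions.\<close>

definition order_isomorphic :: "nat list \<Rightarrow> nat list \<Rightarrow> bool" where
  "order_isomorphic xs ys \<longleftrightarrow> length xs = length ys \<and>
     (\<forall>i<length xs. \<forall>j<length xs. xs ! i < xs ! j \<longleftrightarrow> ys ! i < ys ! j)"

definition occurrences :: "nat list \<Rightarrow> nat list \<Rightarrow> nat set" where
  "occurrences p w =
     {i. i + length p \<le> length w \<and> order_isomorphic (take (length p) (drop i w)) p}"

definition avoids :: "nat list \<Rightarrow> nat list \<Rightarrow> bool" where
  "avoids w p \<longleftrightarrow> occurrences p w = {}"

definition Av :: "nat \<Rightarrow> nat list set \<Rightarrow> nat list set" where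
  "Av n P = {w \<in> permutations_of_set {1..n}. \<forall>p\<in>P. avoids w p}"

definition A_class :: "nat \<Rightarrow> nat list set" where
  "A_class n = Av n {[1,2,3], [1,3,2], [3,2,1]}"

definition total_occ :: "nat list \<Rightarrow> nat \<Rightarrow> nat" where
  "total_occ p n = (\<Sum>w\<in>A_class n. card (occurrences p w))"

end

theory Submission
  imports Defs
begin

text \<open>Words of the class are alternating, and a window with an ascent followed by a descent must
  be a 231, so the valleys decrease and the last valley is the minimum \<open>m\<close>. A word over \<open>S\<close> that
  ends with an ascent is therefore \<open>u m p\<close> with \<open>p\<close> arbitrary in \<open>S - {m}\<close> and \<open>u\<close> a word of the
  same kind over \<open>S - {m, p}\<close>; a word that ends with a descent is \<open>u m\<close> with \<open>u\<close> of this kind over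
  \<open>S - {m}\<close>. The position of the 231s is forced by the alternation. A new 312 arises exactly if
  \<open>p\<close> is smaller than the last letter of \<open>u\<close>, which is equidistributed over the non-minimal letters
  of \<open>u\<close>; summing over \<open>p\<close> gives \<open>b n = (n - 1) * b (n - 2) + n / 2 * (n - 3)!!\<close> for the number \<open>b n\<close>
  of 312s in the \<open>n\<close>-letter words ending with an ascent.\<close>

section \<open>Occurrences of length-three patterns when a word grows at its right end\<close>

lemma finite_occurrences: "finite (occurrences p w)"
  by (rule finite_subset[of _ "{..length w}"]) (auto simp: occurrences_def)

lemma occurrences_short: "length w < length p \<Longrightarrow> occurrences p w = {}"
  by (auto simp: occurrences_def)

text \<open>A window starting before \<open>length v\<close> ends before \<open>c\<close>, so the
  only window that \<open>c\<close> adds is the last one.\<close>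

lemma occurrences_append3:
  assumes "length p = 3"
  shows "occurrences p (v @ [a, b, c]) =
    occurrences p (v @ [a, b]) \<union> (if order_isomorphic [a, b, c] p then {length v} else {})"
proof (rule set_eqI)
  fix i
  consider "i < length v" | "i = length v" | "i > length v" by linarith
  then show "i \<in> occurrences p (v @ [a, b, c]) \<longleftrightarrow>
    i \<in> occurrences p (v @ [a, b]) \<union> (if order_isomorphic [a, b, c] p then {length v} else {})"
  proof cases
    case 1
    then have "take 3 (drop i (v @ [a, b, c])) = take 3 (drop i (v @ [a, b]))"
    proof -
      have "take 3 (drop i ((v @ [a, b]) @ [c])) = take 3 (drop i (v @ [a, b]))"
        using 1 by (simp only: drop_append take_append) simp
      then show ?thesis by simp
    qed
    then show ?thesis using 1 assms by (auto simp: occurrences_def)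
  next
    case 2
    then show ?thesis using assms by (auto simp: occurrences_def)
  next
    case 3
    then show ?thesis using assms by (auto simp: occurrences_def)
  qed
qed

lemma card_occurrences_append3:
  assumes "length p = 3"
  shows "card (occurrences p (v @ [a, b, c])) =
    card (occurrences p (v @ [a, b])) + of_bool (order_isomorphic [a, b, c] p)"
proof -
  have "length v \<notin> occurrences p (v @ [a, b])"
    using assms by (auto simp: occurrences_def)
  then show ?thesis
    using finite_occurrences[of p "v @ [a, b]"] by (simp add: occurrences_append3[OF assms])
qed

lemma less_3_iff: "i < Suc (Suc (Suc 0)) \<longleftrightarrow> i = 0 \<or> i = 1 \<or> i = 2"
  by auto

lemma order_isomorphic_3:
  "order_isomorphic [a, b, c] [x, y, z] \<longleftrightarrow>
    (a < b \<longleftrightarrow> x < y) \<and> (b < a \<longleftrightarrow> y < x) \<and> (a < c \<longleftrightarrow> x < z) \<and> (c < a \<longleftrightarrow> z < x) \<and>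
    (b < c \<longleftrightarrow> y < z) \<and> (c < b \<longleftrightarrow> z < y)"
  unfolding order_isomorphic_def by (auto simp: less_3_iff)

section \<open>Structure of the words that avoid the three patterns\<close>

definition good :: "nat list \<Rightarrow> bool" where
  "good w \<longleftrightarrow> (\<forall>p\<in>{[1,2,3], [1,3,2], [3,2,1]}. avoids w p)"

lemma good_short: "length w < 3 \<Longrightarrow> good w"
  by (auto simp: good_def avoids_def occurrences_short)

text \<open>The three remaining patterns are 231, the only one left that starts with an ascent, and
  213 and 312, which together are a descent followed by an ascent.\<close>

lemma good_append3:
  assumes "distinct [a, b, c]"
  shows "good (v @ [a, b, c]) \<longleftrightarrow> good (v @ [a, b]) \<and> (if a < b then c < a else b < c)"
  using assms unfolding good_def avoids_def
  by (auto simp: occurrences_append3 order_isomorphic_3)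

lemma good_butlast: "good (w @ [x]) \<Longrightarrow> good w"
proof -
  assume *: "good (w @ [x])"
  show "good w"
  proof (cases "length w < 3")
    case False
    then obtain v a b where w: "w = v @ [a, b]"
      by (metis append.assoc append_Cons append_Nil append_butlast_last_id length_greater_0_conv
          length_append_singleton less_Suc_eq_0_disj not_less_eq numeral_3_eq_3)
    with * show ?thesis unfolding good_def avoids_def
      by (auto simp: occurrences_append3)
  qed (rule good_short)
qed

text \<open>The alphabet is arbitrary instead of \<open>{1..n}\<close> because the recursion deletes
  the minimum together with an arbitrary second letter.\<close>

definition good_words :: "nat set \<Rightarrow> nat list set" where
  "good_words S = {w \<in> permutations_of_set S. good w}"

text \<open>Words with fewer than two letters qualify vacuously; they are the base cases of the
  recursion.\<close>

definition ascent_end :: "nat list \<Rightarrow> bool" where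
  "ascent_end w \<longleftrightarrow> (\<forall>v a b. w = v @ [a, b] \<longrightarrow> a < b)"

definition up_words :: "nat set \<Rightarrow> nat list set" where
  "up_words S = {w \<in> good_words S. ascent_end w}"

lemma A_class_eq: "A_class n = good_words {1..n}"
  by (simp add: A_class_def Av_def good_words_def good_def)

lemma ascent_end_simps [simp]:
  "ascent_end []" "ascent_end [x]" "ascent_end (v @ [a, b]) \<longleftrightarrow> a < b"
  "ascent_end [a, b] \<longleftrightarrow> a < b" "ascent_end (v @ [c, a, b]) \<longleftrightarrow> a < b"
proof -
  show *: "ascent_end (v @ [a, b]) \<longleftrightarrow> a < b" for v a b
    by (auto simp: ascent_end_def)
  show "ascent_end []" "ascent_end [x]" by (auto simp: ascent_end_def)
  show "ascent_end [a, b] \<longleftrightarrow> a < b" using *[of "[]"] by simp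
  show "ascent_end (v @ [c, a, b]) \<longleftrightarrow> a < b" using *[of "v @ [c]"] by simp
qed

lemma last_two_cases:
  obtains "w = []" | x where "w = [x]" | v a b where "w = v @ [a, b]"
  by (metis append.assoc append_Cons append_Nil rev_exhaust)

text \<open>Each peak lies between two valleys of which the right one is smaller, so the valleys
  decrease from left to right.\<close>

lemma good_ascent_end_min:
  assumes "good (v @ [a, b])" "distinct (v @ [a, b])" "a < b"
  shows "\<forall>x\<in>set v. a < x"
  using assms
proof (induction "length v" arbitrary: v a b rule: less_induct)
  case less
  show ?case
  proof (cases v rule: last_two_cases)
    case (2 y)
    then show ?thesis using less.prems good_append3[of y a b "[]"] by (auto split: if_splits)
  next
    case (3 u x y)
    \<comment> \<open>Ascents and descents must alternate: \<open>a < b\<close> forces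
      \<open>a < y\<close>, and this forces \<open>x < y\<close>. The window \<open>x y a\<close> is
      then a 231, so the valley \<open>a\<close> lies below the previous valley
      \<open>x\<close>.\<close>
    have g: "good (u @ [x, y, a])" "a < y"
      using less.prems good_append3[of y a b "u @ [x]"] 3 by (auto split: if_splits)
    then have *: "good (u @ [x, y])" "x < y" "a < x"
      using less.prems good_append3[of x y a u] 3 by (auto split: if_splits)
    have "\<forall>z\<in>set u. x < z"
      by (rule less.hyps[of u x y]) (use * less.prems 3 in auto)
    then show ?thesis using * g 3 by auto
  qed auto
qed

text \<open>A descent before the last one would give a 321. So the final window is a 231, which puts
  \<open>b\<close> below the last valley of \<open>v\<close>, itself the minimum of
  \<open>v\<close>.\<close>

lemma good_descent_end:
  assumes "good (v @ [a, b])" "distinct (v @ [a, b])" "b < a"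
  shows "ascent_end (v @ [a])" "\<forall>x\<in>set v. b < x"
proof -
  have "ascent_end (v @ [a]) \<and> (\<forall>x\<in>set v. b < x)"
  proof (cases v rule: rev_exhaust)
    case (snoc u x)
    then have *: "good (u @ [x, a])" "x < a" "b < x"
      using assms good_append3[of x a b u] by (auto split: if_splits)
    then have "\<forall>z\<in>set u. x < z"
      using good_ascent_end_min[of u x a] assms snoc by auto
    then show ?thesis using * snoc by auto
  qed auto
  then show "ascent_end (v @ [a])" "\<forall>x\<in>set v. b < x" by auto
qed

lemma good_append_min:
  assumes "good u" "ascent_end u" "distinct u" "\<forall>x\<in>set u. m < x"
  shows "good (u @ [m])"
proof (cases u rule: last_two_cases)
  case (3 v x y)
  then show ?thesis using assms by (auto simp: good_append3)
qed (auto simp: good_short)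

text \<open>The new minimum \<open>m\<close> closes a 231, or no window at all; the final window
  \<open>y m p\<close> is a 213 or a 312 whatever the size of \<open>p\<close>.\<close>

lemma good_append_min_ascent:
  assumes "good u" "ascent_end u" "distinct u" "\<forall>x\<in>set u. m < x" "m < p" "p \<notin> set u"
  shows "good (u @ [m, p])"
proof (cases u rule: rev_exhaust)
  case (snoc v y)
  then show ?thesis using assms good_append_min[OF assms(1-4)] good_append3[of y m p v] by auto
qed (auto simp: good_short)

lemma set_up_words:
  assumes "u \<in> up_words S"
  shows "set u = S" "distinct u" "good u" "ascent_end u"
  using assms by (auto simp: up_words_def good_words_def permutations_of_set_def)

lemma length_good_words: "u \<in> good_words S \<Longrightarrow> length u = card S"
  by (auto simp: good_words_def length_finite_permutations_of_set)

lemma length_up_words: "u \<in> up_words S \<Longrightarrow> length u = card S"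
  by (auto simp: up_words_def length_good_words)

lemma finite_good_words [simp]: "finite (good_words S)"
  by (simp add: good_words_def)

lemma finite_up_words [simp]: "finite (up_words S)"
  by (simp add: up_words_def)

lemma up_words_empty [simp]: "up_words {} = {[]}"
  by (auto simp: up_words_def good_words_def good_short)

lemma up_words_singleton [simp]: "up_words {x} = {[x]}"
  by (auto simp: up_words_def good_words_def good_short)

lemma Min_less:
  assumes "finite S" "x \<in> S" "x \<noteq> Min S"
  shows "Min S < (x::nat)"
  using assms by (simp add: le_neq_implies_less)

lemma Min_eqI_append:
  assumes "set w = S" "m \<in> set w" "\<And>x. x \<in> set w \<Longrightarrow> x = m \<or> (m::nat) < x"
  shows "m = Min S"
proof (rule sym, rule Min_eqI)
  show "finite S" using assms by auto
  show "m \<in> S" using assms by auto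
  show "m \<le> x" if "x \<in> S" for x using assms that by force
qed

section \<open>Recursive decomposition of the words\<close>

text \<open>Stated as a bijection so that the sum of any statistic, and not only the cardinality,
  can be split along it.\<close>

lemma up_words_rec:
  assumes "finite S" "card S \<ge> 2"
  shows "bij_betw (\<lambda>(p, u). u @ [Min S, p])
           (SIGMA p:S - {Min S}. up_words (S - {Min S, p})) (up_words S)"
proof (rule bij_betw_imageI)
  have "S \<noteq> {}" using assms by auto
  then have min_in: "Min S \<in> S" using assms by simp
  show "inj_on (\<lambda>(p, u). u @ [Min S, p]) (SIGMA p:S - {Min S}. up_words (S - {Min S, p}))"
    by (auto simp: inj_on_def)
  show "(\<lambda>(p, u). u @ [Min S, p]) ` (SIGMA p:S - {Min S}. up_words (S - {Min S, p})) = up_words S"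
  proof (intro equalityI subsetI)
    fix w assume "w \<in> (\<lambda>(p, u). u @ [Min S, p]) ` (SIGMA p:S - {Min S}. up_words (S - {Min S, p}))"
    then obtain p u where w: "w = u @ [Min S, p]" "p \<in> S" "p \<noteq> Min S"
      and u: "u \<in> up_words (S - {Min S, p})" by auto
    note u = set_up_words[OF u]
    have less: "Min S < p" using w assms Min_less by auto
    have "good w" unfolding w(1)
      by (rule good_append_min_ascent) (use u less assms Min_less in auto)
    then show "w \<in> up_words S"
      using u less w min_in by (auto simp: up_words_def good_words_def permutations_of_set_def)
  next
    fix w assume w: "w \<in> up_words S"
    note ws = set_up_words[OF w]
    have "length w \<ge> 2" using length_up_words[OF w] assms by simp
    then obtain u a p where wu: "w = u @ [a, p]" by (cases w rule: last_two_cases) auto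
    then have less: "a < p" using ws by simp
    have min: "\<forall>x\<in>set u. a < x"
      using good_ascent_end_min[of u a p] ws wu less by auto
    have a: "a = Min S"
      by (rule Min_eqI_append[OF ws(1)]) (use wu min less in auto)
    have gu: "good u" "good (u @ [a])"
      using ws(3) wu good_butlast[of "u @ [a]" p] good_butlast[of u a] by auto
    \<comment> \<open>A final descent of \<open>u\<close> followed by the smaller letter
      \<open>a\<close> would be a 321.\<close>
    have asc: "ascent_end u"
    proof (cases u rule: last_two_cases)
      case (3 v x y)
      then show ?thesis using gu(2) good_append3[of x y a v] wu ws min by (auto split: if_splits)
    qed auto
    have "u \<in> up_words (S - {Min S, p})"
      using gu asc ws wu a by (auto simp: up_words_def good_words_def permutations_of_set_def)
    then show "w \<in> (\<lambda>(p, u). u @ [Min S, p]) ` (SIGMA p:S - {Min S}. up_words (S - {Min S, p}))"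
      using wu a ws less by (intro image_eqI[of _ _ "(p, u)"]) auto
  qed
qed

lemma sum_up_words:
  fixes f :: "nat list \<Rightarrow> 'a :: comm_monoid_add"
  assumes "finite S" "card S \<ge> 2"
  shows "(\<Sum>w\<in>up_words S. f w) =
    (\<Sum>p\<in>S - {Min S}. \<Sum>u\<in>up_words (S - {Min S, p}). f (u @ [Min S, p]))"
  using assms
  by (subst sum.reindex_bij_betw[OF up_words_rec[OF assms], symmetric])
     (simp add: sum.Sigma split_def)

lemma sum_good_words:
  fixes f :: "nat list \<Rightarrow> 'a :: comm_monoid_add"
  assumes "finite S" "card S \<ge> 2"
  shows "(\<Sum>w\<in>good_words S. f w) =
    (\<Sum>w\<in>up_words S. f w) + (\<Sum>u\<in>up_words (S - {Min S}). f (u @ [Min S]))"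
proof -
  have "S \<noteq> {}" using assms by auto
  then have min_in: "Min S \<in> S" using assms by simp
  let ?D = "(\<lambda>u. u @ [Min S]) ` up_words (S - {Min S})"
  have split: "good_words S = up_words S \<union> ?D"
  proof (intro equalityI subsetI)
    fix w assume w: "w \<in> good_words S"
    then have ws: "set w = S" "distinct w" "good w"
      by (auto simp: good_words_def permutations_of_set_def)
    have "length w \<ge> 2" using length_good_words[OF w] assms by simp
    then obtain v a b where wv: "w = v @ [a, b]" by (cases w rule: last_two_cases) auto
    show "w \<in> up_words S \<union> ?D"
    proof (cases "a < b")
      case True
      then show ?thesis using w wv by (simp add: up_words_def)
    next
      case False
      then have less: "b < a" using ws wv by auto
      have d: "ascent_end (v @ [a])" "\<forall>x\<in>set v. b < x"
        using good_descent_end[of v a b] ws wv less by auto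
      have b: "b = Min S"
        by (rule Min_eqI_append[OF ws(1)]) (use wv d less in auto)
      have "v @ [a] \<in> up_words (S - {Min S})"
        using d ws wv b good_butlast[of "v @ [a]" b]
        by (auto simp: up_words_def good_words_def permutations_of_set_def)
      then show ?thesis using wv b by (intro UnI2 image_eqI[of _ _ "v @ [a]"]) auto
    qed
  next
    fix w assume "w \<in> up_words S \<union> ?D"
    then show "w \<in> good_words S"
    proof
      assume "w \<in> ?D"
      then obtain u where u: "w = u @ [Min S]" "u \<in> up_words (S - {Min S})" by auto
      note us = set_up_words[OF u(2)]
      have "good w" unfolding u(1)
        by (rule good_append_min) (use us assms Min_less in auto)
      then show ?thesis using us u(1) min_in
        by (auto simp: good_words_def permutations_of_set_def)
    qed (simp add: up_words_def)
  qed
  \<comment> \<open>The minimum cannot be the upper end of an ascent. Two letters are needed here: a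
    one-letter word would lie in both parts.\<close>
  have disj: "up_words S \<inter> ?D = {}"
  proof (rule ccontr)
    assume "up_words S \<inter> ?D \<noteq> {}"
    then obtain u where u: "u @ [Min S] \<in> up_words S" "u \<in> up_words (S - {Min S})" by auto
    have "length u \<ge> 1" using length_up_words[OF u(1)] assms by simp
    then obtain v x where v: "u = v @ [x]" by (cases u rule: rev_exhaust) auto
    have "x < Min S" using set_up_words(4)[OF u(1)] v by simp
    moreover have "x \<in> S" using set_up_words(1)[OF u(2)] v by auto
    ultimately show False using assms by (meson Min_le leD)
  qed
  show ?thesis unfolding split
    by (subst sum.union_disjoint) (use disj in \<open>auto simp: sum.reindex inj_on_def\<close>)
qed

section \<open>Cardinalities\<close>

lemma double_fact_rec: "n \<ge> 2 \<Longrightarrow> double_fact n = n * double_fact (n - 2)"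
  by (cases n rule: double_fact.cases) auto

lemma card_Diff_Min:
  assumes "finite S" "card S \<ge> 2"
  shows "card (S - {Min S}) = card S - 1"
    "p \<in> S - {Min S} \<Longrightarrow> card (S - {Min S, p}) = card S - 2"
proof -
  have "S \<noteq> {}" using assms by auto
  then have min_in: "Min S \<in> S" using assms by simp
  then show "card (S - {Min S}) = card S - 1" by simp
  show "card (S - {Min S, p}) = card S - 2" if "p \<in> S - {Min S}"
    using that min_in assms by (subst card_Diff_subset) auto
qed

lemma card_up_words: "finite S \<Longrightarrow> card (up_words S) = double_fact (card S - 1)"
proof (induction "card S" arbitrary: S rule: less_induct)
  case less
  consider "card S = 0" | "card S = 1" | "card S \<ge> 2" by linarith
  then show ?case
  proof cases
    case 1
    then show ?thesis using less.prems by simp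
  next
    case 2
    then show ?thesis by (auto simp: card_1_singleton_iff)
  next
    case 3
    have IH: "card (up_words (S - {Min S, p})) = double_fact (card S - 2 - 1)"
      if "p \<in> S - {Min S}" for p
      using less.hyps[of "S - {Min S, p}"] that card_Diff_Min(2)[OF less.prems 3] less.prems 3
      by simp
    have "card (up_words S) = (\<Sum>w\<in>up_words S. 1)" by simp
    also have "\<dots> = (\<Sum>p\<in>S - {Min S}. double_fact (card S - 2 - 1))"
      unfolding sum_up_words[OF less.prems 3] by (rule sum.cong) (auto simp: IH)
    also have "\<dots> = (card S - 1) * double_fact (card S - 2 - 1)"
      using card_Diff_Min(1)[OF less.prems 3] by simp
    \<comment> \<open>For two letters the argument \<open>2 - 2 - 1\<close> truncates to 0, and
      \<open>double_fact 0 = 1\<close> is the right count for the empty alphabet.\<close>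
    also have "\<dots> = double_fact (card S - 1)"
      using 3 by (cases "card S = 2") (auto simp: double_fact_rec numeral_eq_Suc)
    finally show ?thesis .
  qed
qed

lemma card_good_words:
  assumes "finite S" "card S \<ge> 2"
  shows "card (good_words S) = double_fact (card S - 1) + double_fact (card S - 2)"
proof -
  have "card (good_words S) = (\<Sum>w\<in>good_words S. 1)" by simp
  also have "\<dots> = card (up_words S) + card (up_words (S - {Min S}))"
    unfolding sum_good_words[OF assms] by simp
  also have "\<dots> = double_fact (card S - 1) + double_fact (card S - 2)"
    using assms card_Diff_Min(1)[OF assms] by (simp add: card_up_words numeral_2_eq_2)
  finally show ?thesis .
qed

section \<open>Effect of the recursion on the numbers of 231s and 312s\<close>

lemma card_231_append_min:
  assumes "ascent_end u" "\<forall>x\<in>set u. m < x"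
  shows "card (occurrences [2,3,1] (u @ [m])) =
    card (occurrences [2,3,1] u) + of_bool (length u \<ge> 2)"
proof (cases u rule: last_two_cases)
  case (3 v x y)
  then show ?thesis using assms by (auto simp: card_occurrences_append3 order_isomorphic_3)
qed (auto simp: occurrences_short)

lemma card_231_append_ascent:
  assumes "m < p"
  shows "card (occurrences [2,3,1] (u @ [m, p])) = card (occurrences [2,3,1] (u @ [m]))"
proof (cases u rule: rev_exhaust)
  case (snoc v y)
  then show ?thesis using assms by (auto simp: card_occurrences_append3 order_isomorphic_3)
qed (auto simp: occurrences_short)

lemma card_312_append_min:
  assumes "ascent_end u"
  shows "card (occurrences [3,1,2] (u @ [m])) = card (occurrences [3,1,2] u)"
proof (cases u rule: last_two_cases)
  case (3 v x y)
  then show ?thesis using assms by (auto simp: card_occurrences_append3 order_isomorphic_3)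
qed (auto simp: occurrences_short)

text \<open>The final window has its minimum in the middle: it is a 312 if \<open>p\<close> lies
  below the last letter of \<open>u\<close>, and a 213 otherwise.\<close>

lemma card_312_append_ascent:
  assumes "m < p" "\<forall>x\<in>set u. m < x"
  shows "card (occurrences [3,1,2] (u @ [m, p])) =
    card (occurrences [3,1,2] (u @ [m])) + of_bool (u \<noteq> [] \<and> p < last u)"
proof (cases u rule: rev_exhaust)
  case (snoc v y)
  then show ?thesis using assms by (auto simp: card_occurrences_append3 order_isomorphic_3)
qed (auto simp: occurrences_short)

text \<open>The count does not depend on the word: appending \<open>m\<close> and \<open>p\<close>
  creates exactly one 231, ending in \<open>m\<close>, as soon as \<open>u\<close> has two
  letters.\<close>

lemma card_231_up_words:
  "finite S \<Longrightarrow> w \<in> up_words S \<Longrightarrow> card (occurrences [2,3,1] w) = (card S - 2) div 2"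
proof (induction "card S" arbitrary: S w rule: less_induct)
  case less
  show ?case
  proof (cases "card S \<ge> 2")
    case False
    then show ?thesis using length_up_words[OF less.prems(2)] by (simp add: occurrences_short)
  next
    case True
    obtain p u where w: "w = u @ [Min S, p]" "p \<in> S - {Min S}"
      and u: "u \<in> up_words (S - {Min S, p})"
      using less.prems(2)
      unfolding bij_betw_imp_surj_on[OF up_words_rec[OF less.prems(1) True], symmetric]
      by (elim imageE SigmaE) auto
    note us = set_up_words[OF u]
    have m: "Min S < p" "\<forall>x\<in>set u. Min S < x"
      using Min_less[OF less.prems(1)] w us by auto
    have c: "card (S - {Min S, p}) = card S - 2"
      using card_Diff_Min(2)[OF less.prems(1) True w(2)] .
    have IH: "card (occurrences [2,3,1] u) = (card S - 2 - 2) div 2"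
      using less.hyps[OF _ _ u] c True less.prems(1) by simp
    show ?thesis
      unfolding w(1) card_231_append_ascent[OF m(1)] card_231_append_min[OF us(4) m(2)] IH
      using length_up_words[OF u] c True by auto
  qed
qed

section \<open>Total number of 312s in the words ending with an ascent\<close>

text \<open>Each unordered pair is counted once, at its smaller element. In the induction the new
  element \<open>b\<close> is the minimum: it pairs with all of \<open>A\<close> and leaves the
  other counts unchanged.\<close>

lemma sum_card_less_pairs:
  "finite (R :: nat set) \<Longrightarrow> 2 * (\<Sum>p\<in>R. card {q\<in>R. p < q}) = card R * (card R - 1)"
proof (induction rule: finite_linorder_min_induct)
  case (insert b A)
  have b: "{q \<in> insert b A. b < q} = A" using insert by auto
  have p: "{q \<in> insert b A. p < q} = {q \<in> A. p < q}" if "p \<in> A" for p using insert that by auto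
  have "b \<notin> A" using insert by auto
  then have "2 * (\<Sum>p\<in>insert b A. card {q\<in>insert b A. p < q}) =
    2 * card A + 2 * (\<Sum>p\<in>A. card {q\<in>A. p < q})"
    unfolding sum.insert[OF insert.hyps(1) \<open>b \<notin> A\<close>] b distrib_left
    using sum.cong[OF refl arg_cong[OF p, of _ card]] by simp
  also have "\<dots> = 2 * card A + card A * (card A - 1)"
    using insert.IH by simp
  also have "\<dots> = card (insert b A) * (card (insert b A) - 1)"
    using insert \<open>b \<notin> A\<close> by (cases "card A") auto
  finally show ?case .
qed simp

text \<open>The last letter ranges over the non-minimal letters of \<open>T\<close>, and each of
  them has the same number of possible prefixes, by \<open>card_up_words\<close>.\<close>

lemma sum_last_greater:
  assumes "finite T" "card T \<ge> 2"
  shows "(\<Sum>u\<in>up_words T. of_bool (u \<noteq> [] \<and> p < last u)) =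
    card {q \<in> T - {Min T}. p < q} * double_fact (card T - 3)"
proof -
  have "(\<Sum>u\<in>up_words T. of_bool (u \<noteq> [] \<and> p < last u)) =
     (\<Sum>q\<in>T - {Min T}. of_bool (p < q) * double_fact (card T - 3))"
    unfolding sum_up_words[OF assms] using assms(1)
    by (intro sum.cong) (auto simp: card_up_words card_Diff_Min[OF assms])
  also have "\<dots> = card {q \<in> T - {Min T}. p < q} * double_fact (card T - 3)"
  proof -
    have "{q \<in> T - {Min T}. p < q} = (T - {Min T}) \<inter> {q. p < q}" by auto
    then show ?thesis using assms(1) by (simp add: sum_distrib_right[symmetric] sum_of_bool_eq)
  qed
  finally show ?thesis .
qed

text \<open>With r = \<open>card R\<close>, the choice p = \<open>Min R\<close> contributes r - 2,
  since one of the r - 1 larger letters is the new minimum. Every other \<open>p\<close> leaves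
  \<open>Min R\<close> as the minimum, so these choices count the pairs in the remaining r - 1
  letters.\<close>

lemma sum_card_greater_nonmin:
  assumes "finite (R :: nat set)" "card R \<ge> 3"
  shows "2 * (\<Sum>p\<in>R. card {q \<in> R - {p} - {Min (R - {p})}. p < q}) = (card R + 1) * (card R - 2)"
proof -
  have ne: "R \<noteq> {}" using assms by auto
  then have min_in: "Min R \<in> R" using assms by simp
  let ?m = "Min R" and ?R = "R - {Min R}"
  have cR: "card ?R = card R - 1" using min_in by simp
  then have "card ?R \<noteq> 0" using assms by simp
  then have "?R \<noteq> {}" by fastforce
  then have Min2: "Min ?R \<in> ?R" using assms by (intro Min_in) auto
  have "{q \<in> R - {?m} - {Min ?R}. ?m < q} = ?R - {Min ?R}"
    using Min_less assms(1) by auto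
  then have m: "card {q \<in> R - {?m} - {Min ?R}. ?m < q} = card R - 2"
    using Min2 cR by simp
  have p: "{q \<in> R - {p} - {Min (R - {p})}. p < q} = {q \<in> ?R. p < q}" if "p \<in> ?R" for p
  proof -
    have "Min (R - {p}) = ?m"
      by (rule Min_eqI) (use assms(1) that min_in in auto)
    then show ?thesis by auto
  qed
  have "(\<Sum>p\<in>R. card {q \<in> R - {p} - {Min (R - {p})}. p < q}) =
     (card R - 2) + (\<Sum>p\<in>?R. card {q \<in> ?R. p < q})"
    using m p by (simp add: sum.remove[OF assms(1) min_in])
  then have "2 * (\<Sum>p\<in>R. card {q \<in> R - {p} - {Min (R - {p})}. p < q}) =
     2 * (card R - 2) + (card R - 1) * (card R - 2)"
    using sum_card_less_pairs[of ?R] assms(1) cR by (simp add: numeral_2_eq_2)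
  also have "\<dots> = (card R + 1) * (card R - 2)"
    using assms(2) by (simp add: add_mult_distrib[symmetric])
  finally show ?thesis .
qed

lemma sum_312_rec:
  assumes "finite S" "card S \<ge> 2"
  shows "(\<Sum>w\<in>up_words S. card (occurrences [3,1,2] w)) =
    (\<Sum>p\<in>S - {Min S}. (\<Sum>u\<in>up_words (S - {Min S, p}). card (occurrences [3,1,2] u)) +
       (\<Sum>u\<in>up_words (S - {Min S, p}). of_bool (u \<noteq> [] \<and> p < last u)))"
  unfolding sum_up_words[OF assms] sum.distrib[symmetric]
proof (intro sum.cong refl)
  fix p u assume p: "p \<in> S - {Min S}" and u: "u \<in> up_words (S - {Min S, p})"
  note us = set_up_words[OF u]
  have m: "Min S < p" "\<forall>x\<in>set u. Min S < x"
    using Min_less[OF assms(1)] p us by auto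
  show "card (occurrences [3,1,2] (u @ [Min S, p])) =
    card (occurrences [3,1,2] u) + of_bool (u \<noteq> [] \<and> p < last u)"
    unfolding card_312_append_ascent[OF m] card_312_append_min[OF us(4)] ..
qed

text \<open>For \<open>n \<ge> 2\<close>, the average number of 312s in the \<open>n\<close>-letter words ending with an ascent.\<close>

definition mean_312 :: "nat \<Rightarrow> real" where
  "mean_312 n = ((-1) ^ (n - 1) + real n - 3) / 4
     + 1 / 2 * (\<Sum>k | 1 \<le> k \<and> k \<le> n - 1 \<and> k mod 2 \<noteq> n mod 2. 1 / real k)"

lemma mean_312_2: "mean_312 2 = 0"
proof -
  have "{k. 1 \<le> k \<and> k \<le> (2::nat) - 1 \<and> k mod 2 \<noteq> 2 mod 2} = {1}" by auto
  then show ?thesis by (simp add: mean_312_def)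
qed

lemma mean_312_3: "mean_312 3 = 1 / 2"
proof -
  have "{k. 1 \<le> k \<and> k \<le> (3::nat) - 1 \<and> k mod 2 \<noteq> 3 mod 2} = {2}"
    by (auto simp: le_Suc_eq)
  then show ?thesis by (simp add: mean_312_def)
qed

text \<open>From n - 2 to n the sign stays, the linear term grows by 1/2, and the sum gains the
  index k = n - 1; 1/2 + 1/(2(n - 1)) is the stated increment.\<close>

lemma mean_312_rec:
  assumes "n \<ge> 3"
  shows "mean_312 n = mean_312 (n - 2) + real n / (2 * (real n - 1))"
proof -
  have n: "n = Suc (Suc (Suc (n - 3)))" using assms by simp
  define m where "m = n - 3"
  note n = n[folded m_def]
  have "{k. 1 \<le> k \<and> k \<le> n - 1 \<and> k mod 2 \<noteq> n mod 2} =
    insert (n - 1) {k. 1 \<le> k \<and> k \<le> n - 2 - 1 \<and> k mod 2 \<noteq> (n - 2) mod 2}"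
    unfolding n by (auto simp: le_Suc_eq mod_Suc split: if_splits)
  moreover have "finite {k. 1 \<le> k \<and> k \<le> n - 2 - 1 \<and> k mod 2 \<noteq> (n - 2) mod 2}"
    by (rule finite_subset[of _ "{..n}"]) auto
  ultimately show ?thesis
    using n by (simp add: mean_312_def field_simps)
qed

lemma sum_312_up_words:
  "finite S \<Longrightarrow> card S \<ge> 2 \<Longrightarrow>
    real (\<Sum>w\<in>up_words S. card (occurrences [3,1,2] w)) = double_fact (card S - 1) * mean_312 (card S)"
proof (induction "card S" arbitrary: S rule: less_induct)
  case less
  let ?n = "card S" and ?X = "\<lambda>S. \<Sum>w\<in>up_words S. card (occurrences [3,1,2] w)"
  let ?R = "S - {Min S}"
  note rec = sum_312_rec[OF less.prems]
  note cd = card_Diff_Min[OF less.prems]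
  have zero: "?X T = 0" if "card T < 3" for T
    using that length_up_words by (auto simp: occurrences_short)
  consider "?n = 2" | "?n = 3" | "?n \<ge> 4" using less.prems by linarith
  then show ?case
  proof cases
    case 1
    then show ?thesis using zero[of S] by (simp add: mean_312_2)
  next
    \<comment> \<open>The recursion would lead to one-letter words, where the closed form gives -1/4
      instead of 0, so this case is done directly. Of the two choices for the last letter, only the
      smaller one, \<open>a\<close> after \<open>u = [b]\<close>, yields a 312.\<close>
    case 2
    then have "card ?R = 2" using cd(1) by simp
    then obtain x y where "?R = {x, y}" "x \<noteq> y" by (auto simp only: card_2_iff)
    then obtain a b where ab: "?R = {a, b}" "a < b"
      by (metis insert_commute linorder_neqE_nat)
    have eq: "S - {Min S, p} = ?R - {p}" for p by auto
    have "?X S = (\<Sum>p\<in>?R. \<Sum>u\<in>up_words (?R - {p}). of_bool (u \<noteq> [] \<and> p < last u))"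
      unfolding rec eq[symmetric]
    proof (intro sum.cong refl)
      fix p assume "p \<in> ?R"
      then have "card (S - {Min S, p}) < 3" using cd(2) 2 by simp
      then have "?X (S - {Min S, p}) = 0" by (rule zero)
      then show "?X (S - {Min S, p}) + (\<Sum>u\<in>up_words (S - {Min S, p}). of_bool (u \<noteq> [] \<and> p < last u)) =
        (\<Sum>u\<in>up_words (S - {Min S, p}). of_bool (u \<noteq> [] \<and> p < last u))" by linarith
    qed
    also have "\<dots> = 1"
    proof -
      have "{a, b} - {a} = {b}" "{a, b} - {b} = {a}" using ab by auto
      then show ?thesis using ab by simp
    qed
    finally show ?thesis using 2 by (simp add: mean_312_3 numeral_2_eq_2)
  next
    case 3
    have IH: "real (?X (S - {Min S, p})) = double_fact (?n - 3) * mean_312 (?n - 2)"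
      if "p \<in> ?R" for p
      using less.hyps[of "S - {Min S, p}"] cd(2)[OF that] less.prems 3 by simp
    have eq: "S - {Min S, p} = ?R - {p}" for p by auto
    have L: "(\<Sum>u\<in>up_words (S - {Min S, p}). of_bool (u \<noteq> [] \<and> p < last u)) =
      card {q \<in> ?R - {p} - {Min (?R - {p})}. p < q} * double_fact (?n - 5)" if "p \<in> ?R" for p
      using sum_last_greater[of "S - {Min S, p}" p] cd(2)[OF that] less.prems 3
      unfolding eq by simp
    have P: "2 * (\<Sum>p\<in>?R. card {q \<in> ?R - {p} - {Min (?R - {p})}. p < q}) = ?n * (?n - 3)"
    proof -
      have "card ?R + 1 = ?n" "card ?R - 2 = ?n - 3" "card ?R \<ge> 3" using cd(1) 3 by linarith+
      then show ?thesis using sum_card_greater_nonmin[of ?R] less.prems(1) by (metis finite_Diff)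
    qed
    \<comment> \<open>For four letters \<open>?n - 5\<close> truncates to 0, which still gives the
      correct product 1.\<close>
    have df: "(?n - 3) * double_fact (?n - 5) = double_fact (?n - 3)"
    proof (cases "?n = 4")
      case False
      then show ?thesis using 3 double_fact_rec[of "?n - 3"] by simp
    qed simp
    have "?X S = (\<Sum>p\<in>?R. ?X (S - {Min S, p})) +
      (\<Sum>p\<in>?R. card {q \<in> ?R - {p} - {Min (?R - {p})}. p < q}) * double_fact (?n - 5)"
      unfolding rec sum.distrib sum_distrib_right
      by (intro arg_cong2[where f = "(+)"] refl sum.cong L)
    then have "2 * ?X S = 2 * (\<Sum>p\<in>?R. ?X (S - {Min S, p})) + ?n * double_fact (?n - 3)"
      unfolding df[symmetric] mult.assoc[symmetric] P[symmetric] by linarith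
    then have "real (2 * ?X S) =
      real (2 * (\<Sum>p\<in>?R. ?X (S - {Min S, p})) + ?n * double_fact (?n - 3))"
      by (rule arg_cong)
    then have "2 * real (?X S) = 2 * (\<Sum>p\<in>?R. real (?X (S - {Min S, p}))) +
      real ?n * real (double_fact (?n - 3))"
      by (simp only: of_nat_add of_nat_mult of_nat_numeral of_nat_sum)
    also have "(\<Sum>p\<in>?R. real (?X (S - {Min S, p}))) =
      (real ?n - 1) * (double_fact (?n - 3) * mean_312 (?n - 2))"
    proof -
      have "(\<Sum>p\<in>?R. real (?X (S - {Min S, p}))) =
        (\<Sum>p\<in>?R. double_fact (?n - 3) * mean_312 (?n - 2))"
        by (intro sum.cong refl IH)
      then show ?thesis using cd(1) 3 by (simp add: of_nat_diff)
    qed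
    \<comment> \<open>This is \<open>mean_312_rec\<close> multiplied by 2(n - 1)(n - 3)!!; dividing
      the recurrence for the totals by (n - 1)!! is what turns it into the one for the
      means.\<close>
    also have "2 * \<dots> + real ?n * real (double_fact (?n - 3)) =
      2 * ((real ?n - 1) * double_fact (?n - 3) * mean_312 ?n)"
      using 3 by (simp add: mean_312_rec[of ?n] field_simps)
    also have "(real ?n - 1) * double_fact (?n - 3) = double_fact (?n - 1)"
    proof -
      have "?n - 1 - 2 = ?n - 3" by simp
      then show ?thesis using 3 double_fact_rec[of "?n - 1"] by (simp add: of_nat_diff)
    qed
    finally show ?thesis by simp
  qed
qed

section \<open>Totals over the whole class\<close>

text \<open>Every window shows exactly one of the three patterns that are not forbidden.\<close>

lemma card_occurrences_good:
  "good w \<Longrightarrow> distinct w \<Longrightarrow> card (occurrences [2,3,1] w) + card (occurrences [3,1,2] w) +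
     card (occurrences [2,1,3] w) = length w - 2"
proof (induction w rule: rev_induct)
  case (snoc c w)
  show ?case
  proof (cases w rule: last_two_cases)
    case (3 v a b)
    have "card (occurrences [2,3,1] w) + card (occurrences [3,1,2] w) +
     card (occurrences [2,1,3] w) = length w - 2"
      using snoc good_butlast by auto
    moreover have "if a < b then c < a else b < c" "distinct [a, b, c]"
      using snoc.prems 3 good_append3[of a b c v] by auto
    ultimately show ?thesis using 3
      by (auto simp: card_occurrences_append3 order_isomorphic_3 split: if_splits)
  qed (auto simp: occurrences_short)
qed (simp add: occurrences_short)

lemma total_231:
  assumes "n \<ge> 3"
  shows "total_occ [2,3,1] n =
    double_fact (n - 1) * ((n - 2) div 2) + double_fact (n - 2) * ((n - 1) div 2)"
proof -
  let ?S = "{1..n}"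
  have S: "finite ?S" "card ?S \<ge> 2" using assms by auto
  have "(\<Sum>w\<in>up_words ?S. card (occurrences [2,3,1] w)) = double_fact (n - 1) * ((n - 2) div 2)"
    using card_231_up_words[OF S(1)] by (simp add: card_up_words)
  moreover have "(\<Sum>u\<in>up_words (?S - {Min ?S}). card (occurrences [2,3,1] (u @ [Min ?S]))) =
    (\<Sum>u\<in>up_words (?S - {Min ?S}). (n - 1) div 2)"
  proof (rule sum.cong)
    fix u assume u: "u \<in> up_words (?S - {Min ?S})"
    note us = set_up_words[OF u]
    have "\<forall>x\<in>set u. Min ?S < x" using us Min_less[OF S(1)] by auto
    moreover have "card (occurrences [2,3,1] u) = (n - 1 - 2) div 2"
      using card_231_up_words[OF _ u] card_Diff_Min(1)[OF S] by simp
    moreover have "length u = n - 1"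
      using length_up_words[OF u] card_Diff_Min(1)[OF S] by simp
    \<comment> \<open>Here \<open>u\<close> has at least two letters, so the final minimum adds one
      231 to the (n - 3) div 2 in \<open>u\<close>.\<close>
    ultimately show "card (occurrences [2,3,1] (u @ [Min ?S])) = (n - 1) div 2"
      using assms by (subst card_231_append_min[OF us(4)]) auto
  qed simp
  ultimately show ?thesis
    unfolding total_occ_def A_class_eq sum_good_words[OF S]
    using card_Diff_Min(1)[OF S] card_up_words[of "?S - {Min ?S}"]
    by (simp add: numeral_2_eq_2)
qed

text \<open>A final descent to the minimum creates no 312, so the second term is the total over n -
  1 letters.\<close>

lemma total_312:
  assumes "n \<ge> 3"
  shows "real (total_occ [3,1,2] n) =
    double_fact (n - 1) * mean_312 n + double_fact (n - 2) * mean_312 (n - 1)"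
proof -
  let ?S = "{1..n}"
  have S: "finite ?S" "card ?S \<ge> 2" using assms by auto
  have "(\<Sum>u\<in>up_words (?S - {Min ?S}). card (occurrences [3,1,2] (u @ [Min ?S]))) =
    (\<Sum>u\<in>up_words (?S - {Min ?S}). card (occurrences [3,1,2] u))"
    by (intro sum.cong refl card_312_append_min) (rule set_up_words)
  then show ?thesis
    unfolding total_occ_def A_class_eq sum_good_words[OF S]
    using card_Diff_Min(1)[OF S] sum_312_up_words[OF S] sum_312_up_words[of "?S - {Min ?S}"] assms
    by (simp add: numeral_2_eq_2)
qed

lemma total_sum:
  "total_occ [2,3,1] n + total_occ [3,1,2] n + total_occ [2,1,3] n = (n - 2) * card (A_class n)"
proof -
  have "total_occ [2,3,1] n + total_occ [3,1,2] n + total_occ [2,1,3] n = (\<Sum>w\<in>A_class n. n - 2)"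
    unfolding total_occ_def sum.distrib[symmetric]
  proof (rule sum.cong)
    fix w assume "w \<in> A_class n"
    then have w: "w \<in> good_words {1..n}" by (simp add: A_class_eq)
    then show "card (occurrences [2,3,1] w) + card (occurrences [3,1,2] w) +
      card (occurrences [2,1,3] w) = n - 2"
      using card_occurrences_good[of w] length_good_words[OF w]
      by (auto simp: good_words_def permutations_of_set_def)
  qed simp
  then show ?thesis by simp
qed

text \<open>Converts the integer divisions of \<open>total_231\<close> into ceilings, with m = n - 2
  and m = n - 1.\<close>

lemma ceiling_half: "\<lceil>(real m - 1) / 2\<rceil> = int (m div 2)"
proof (rule ceiling_unique)
  have "real m = 2 * real (m div 2) + real (m mod 2)"
    by (metis mult_div_mod_eq of_nat_add of_nat_mult of_nat_numeral)
  moreover have "m mod 2 = 0 \<or> m mod 2 = 1" by auto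
  ultimately show "real_of_int (int (m div 2)) - 1 < (real m - 1) / 2"
    "(real m - 1) / 2 \<le> real_of_int (int (m div 2))"
    by auto
qed

theorem mainTheorem1:
  fixes n :: nat
  shows "(n \<ge> 2 \<longrightarrow> card (A_class n) = double_fact (n - 1) + double_fact (n - 2)) \<and>
    (n \<ge> 3 \<longrightarrow>
       real (total_occ [2,3,1] n) =
           real (double_fact (n - 1)) * of_int \<lceil>(real n - 3) / 2\<rceil>
         + real (double_fact (n - 2)) * of_int \<lceil>(real n - 2) / 2\<rceil> \<and>
       real (total_occ [3,1,2] n) =
           real (double_fact (n - 1)) *
             (((-1) ^ (n - 1) + real n - 3) / 4
               + 1 / 2 * (\<Sum>k | 1 \<le> k \<and> k \<le> n - 1 \<and> k mod 2 \<noteq> n mod 2. 1 / real k))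
         + real (double_fact (n - 2)) *
             (((-1) ^ n + real n - 4) / 4
               + 1 / 2 * (\<Sum>k | 1 \<le> k \<and> k \<le> n - 2 \<and> k mod 2 = n mod 2. 1 / real k)) \<and>
       real (total_occ [2,1,3] n) =
           (real n - 2) * (real (double_fact (n - 1)) + real (double_fact (n - 2)))
         - real (total_occ [2,3,1] n) - real (total_occ [3,1,2] n))"
proof (intro conjI impI)
  show card: "card (A_class n) = double_fact (n - 1) + double_fact (n - 2)" if "n \<ge> 2"
    using card_good_words[of "{1..n}"] that by (simp add: A_class_eq)
  assume n: "n \<ge> 3"
  show "real (total_occ [2,3,1] n) =
           real (double_fact (n - 1)) * of_int \<lceil>(real n - 3) / 2\<rceil>
         + real (double_fact (n - 2)) * of_int \<lceil>(real n - 2) / 2\<rceil>"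
    using total_231[OF n] ceiling_half[of "n - 2"] ceiling_half[of "n - 1"] n
    by (simp add: of_nat_diff)
  have "mean_312 (n - 1) = ((-1) ^ n + real n - 4) / 4
      + 1 / 2 * (\<Sum>k | 1 \<le> k \<and> k \<le> n - 2 \<and> k mod 2 = n mod 2. 1 / real k)"
  proof -
    define m where "m = n - 2"
    then have m: "n = Suc (Suc m)" using n by simp
    \<comment> \<open>Differing in parity from n - 1 means agreeing in parity with n, which gives
      the index set of the second sum.\<close>
    have "k mod 2 \<noteq> Suc m mod 2 \<longleftrightarrow> k mod 2 = m mod 2" for k by presburger
    then show ?thesis by (simp add: mean_312_def m)
  qed
  then show "real (total_occ [3,1,2] n) =
           real (double_fact (n - 1)) *
             (((-1) ^ (n - 1) + real n - 3) / 4
               + 1 / 2 * (\<Sum>k | 1 \<le> k \<and> k \<le> n - 1 \<and> k mod 2 \<noteq> n mod 2. 1 / real k))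
         + real (double_fact (n - 2)) *
             (((-1) ^ n + real n - 4) / 4
               + 1 / 2 * (\<Sum>k | 1 \<le> k \<and> k \<le> n - 2 \<and> k mod 2 = n mod 2. 1 / real k))"
    using total_312[OF n] by (simp only: mean_312_def[of n])
  have "real (total_occ [2,3,1] n) + real (total_occ [3,1,2] n) + real (total_occ [2,1,3] n) =
      (real n - 2) * (real (double_fact (n - 1)) + real (double_fact (n - 2)))"
    using arg_cong[OF total_sum[of n], of real] card n by (simp add: of_nat_diff)
  then show "real (total_occ [2,1,3] n) =
           (real n - 2) * (real (double_fact (n - 1)) + real (double_fact (n - 2)))
         - real (total_occ [2,3,1] n) - real (total_occ [3,1,2] n)"
    by linarith
qed

end
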